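(* Let $R$ be a far-flung Gorenstein complete numerical semigroup ring such that either $\operatorname{type}(R)\leq 3$, or $\operatorname{type}(R)=4$ and $R$ is of non-minimal multiplicity. Then $R$ has maximal reduced type.
   Context: $\Bbbk$ is an algebraically closed field of characteristic $0$. A numerical semigroup is a submonoid $H$ of $\mathbb N=\{0,1,2,\dots\}$ with finite complement; here $H\ne\mathbb N$ is minimally generated by $a_1<\dots<a_n$, and the associated complete numerical semigroup ring is $R=\Bbbk[[H]]=\Bbbk[[t^{a_1},\dots,t^{a_n}]]\subseteq\overline R=\Bbbk[[t]]$, with maximal ideal $\mathfrak m$. Its multiplicity is $e(R)=a_1$ and its embedding dimension is $\operatorname{edim}(R)=n$; $R$ is of minimal multiplicity if $e(R)=\operatorname{edim}(R)$. The conductor of $R$ is $\mathfrak C=R:_{\operatorname{Frac}(R)}\overline R$. The reduced type is $s(R)=\dim_\Bbbk\frac{\mathfrak C+t^{a_1}R}{t^{a_1}R}$ and the Cohen–Macaulay type is $\operatorname{type}(R)=\dim_\Bbbk\frac{t^{a_1}R:_R\mathfrak m}{t^{a_1}R}$; $R$ is of maximal reduced type if $s(R)=\operatorname{type}(R)$. $R$ is far-flung Gorenstein if the trace ideal of its canonical module $\omega_R$, namely $\sum_{f\in\operatorname{Hom}_R(\omega_R,R)}f(\omega_R)$, equals $\mathfrak C$. (Such rings, being non-regular, are non-Gorenstein.) *)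

theory Defs
  imports
    "HOL-Computational_Algebra.Computational_Algebra"
    "HOL-Library.Set_Algebras"
begin

subsection \<open>Numerical semigroups\<close>

definition submonoid :: "nat set \<Rightarrow> bool" where
  "submonoid M \<longleftrightarrow> 0 \<in> M \<and> (\<forall>x\<in>M. \<forall>y\<in>M. x + y \<in> M)"

definition numerical_semigroup :: "nat set \<Rightarrow> bool" where
  "numerical_semigroup H \<longleftrightarrow> submonoid H \<and> finite (UNIV - H)"

definition minimal_generators :: "nat set \<Rightarrow> nat set \<Rightarrow> bool" where
  "minimal_generators A H \<longleftrightarrow>
     finite A \<and> submonoid hull A = H \<and> (\<forall>B. B \<subset> A \<longrightarrow> submonoid hull B \<noteq> H)"


subsection \<open>Rings and modules inside the field of Laurent series\<close>

text \<open>
  All rings and fractional ideals are subsets of the field \<open>'k fls\<close> of formal Laurent series,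
  which is the fraction field of \<open>semigroup_ring H\<close> for every numerical semigroup \<open>H\<close>.
\<close>

definition power_series_ring :: "'k::field fls set" where
  "power_series_ring = range fps_to_fls"

definition semigroup_ring :: "nat set \<Rightarrow> 'k::field fls set" where
  "semigroup_ring H = fps_to_fls ` {f. \<forall>n. fps_nth f n \<noteq> 0 \<longrightarrow> n \<in> H}"

text \<open>The non-units of \<open>R\<close>; these form the maximal ideal because the rings considered are local.\<close>

definition max_ideal :: "'k::field fls set \<Rightarrow> 'k fls set" where
  "max_ideal R = {f \<in> R. \<not> (\<exists>g\<in>R. f * g = 1)}"

text \<open>The colon is taken in the fraction field; the colon in \<open>R\<close> is \<open>R \<inter> colon I J\<close>.\<close>

definition colon :: "'k::field fls set \<Rightarrow> 'k fls set \<Rightarrow> 'k fls set" where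
  "colon I J = {x. \<forall>y\<in>J. x * y \<in> I}"

definition conductor :: "'k::field fls set \<Rightarrow> 'k fls set" where
  "conductor R = colon R power_series_ring"

definition submodule :: "'k::field fls set \<Rightarrow> 'k fls set \<Rightarrow> bool" where
  "submodule R M \<longleftrightarrow>
     0 \<in> M \<and> (\<forall>x\<in>M. \<forall>y\<in>M. x + y \<in> M) \<and> (\<forall>r\<in>R. \<forall>x\<in>M. r * x \<in> M)"

definition fractional_ideal :: "'k::field fls set \<Rightarrow> 'k fls set \<Rightarrow> bool" where
  "fractional_ideal R I \<longleftrightarrow>
     submodule R I \<and> I \<noteq> {0} \<and> (\<exists>d\<in>R - {0}. \<forall>x\<in>I. d * x \<in> R)"


subsection \<open>Canonical module, trace ideal and far-flung Gorenstein rings\<close>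

text \<open>
  The definition of Herzog and Kunz for one-dimensional Cohen--Macaulay rings: a canonical module
  is a fractional ideal with respect to which every fractional ideal is reflexive. It is unique up
  to isomorphism, and the trace ideal depends only on the isomorphism class.
\<close>

definition canonical_module :: "'k::field fls set \<Rightarrow> 'k fls set \<Rightarrow> bool" where
  "canonical_module R W \<longleftrightarrow>
     fractional_ideal R W \<and> (\<forall>I. fractional_ideal R I \<longrightarrow> colon W (colon W I) = I)"

text \<open>Only the values on \<open>M\<close> matter.\<close>

definition module_hom ::
    "'k::field fls set \<Rightarrow> 'k fls set \<Rightarrow> 'k fls set \<Rightarrow> ('k fls \<Rightarrow> 'k fls) set" where
  "module_hom R M N =
     {f. (\<forall>x\<in>M. f x \<in> N) \<and>
         (\<forall>x\<in>M. \<forall>y\<in>M. f (x + y) = f x + f y) \<and>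
         (\<forall>r\<in>R. \<forall>x\<in>M. f (r * x) = r * f x)}"

text \<open>The sum of a family of submodules is the smallest submodule containing all of them.\<close>

definition trace_ideal :: "'k::field fls set \<Rightarrow> 'k fls set \<Rightarrow> 'k fls set" where
  "trace_ideal R M = submodule R hull (\<Union>f\<in>module_hom R M R. f ` M)"

definition far_flung_Gorenstein :: "'k::field fls set \<Rightarrow> bool" where
  "far_flung_Gorenstein R \<longleftrightarrow>
     (\<exists>W. canonical_module R W \<and> trace_ideal R W = conductor R)"


subsection \<open>Dimension of quotient spaces\<close>

text \<open>\<open>B \<subseteq> V\<close> represents, without repetition, a finite basis of the vector space \<open>V / W\<close>.\<close>

definition quotient_basis :: "'k::field fls set \<Rightarrow> 'k fls set \<Rightarrow> 'k fls set \<Rightarrow> bool" where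
  "quotient_basis V W B \<longleftrightarrow>
     finite B \<and> B \<subseteq> V \<and>
     (\<forall>v\<in>V. \<exists>c. v - (\<Sum>b\<in>B. fls_const (c b) * b) \<in> W) \<and>
     (\<forall>c. (\<Sum>b\<in>B. fls_const (c b) * b) \<in> W \<longrightarrow> (\<forall>b\<in>B. c b = 0))"

definition quotient_dim :: "'k::field fls set \<Rightarrow> 'k fls set \<Rightarrow> nat" where
  "quotient_dim V W = (THE n. \<exists>B. quotient_basis V W B \<and> card B = n)"

lemma vector_space_fls: "vector_space (\<lambda>c f. fls_const c * f :: 'k::field fls)"
proof
  fix a b :: 'k and x y :: "'k fls"
  show "fls_const a * (x + y) = fls_const a * x + fls_const a * y"
    by (rule distrib_left)
  show "fls_const (a + b) * x = fls_const a * x + fls_const b * x"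
    by (simp only: fls_plus_const[symmetric] distrib_right)
  show "fls_const a * (fls_const b * x) = fls_const (a * b) * x"
    by (simp only: fls_const_mult_const[symmetric] mult.assoc)
  show "fls_const 1 * x = x"
    by simp
qed

lemma quotient_basis_card_le:
  fixes V W :: "'k::field fls set"
  assumes W: "submodule (range fls_const) W"
    and B: "quotient_basis V W B" and C: "quotient_basis V W C"
  shows "card B \<le> card C"
proof -
  interpret vs: vector_space "\<lambda>c f. fls_const c * f :: 'k fls"
    by (rule vector_space_fls)
  have subW: "vs.subspace W"
    using W unfolding submodule_def vs.subspace_def by blast
  have finB: "finite B" and finC: "finite C"
    using B C unfolding quotient_basis_def by auto
  have "\<forall>b\<in>B. \<exists>c. b - (\<Sum>x\<in>C. fls_const (c x) * x) \<in> W"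
    using B C unfolding quotient_basis_def by blast
  then obtain a where a: "\<And>b. b \<in> B \<Longrightarrow> b - (\<Sum>x\<in>C. fls_const (a b x) * x) \<in> W"
    by metis
  define p where "p b = (\<Sum>x\<in>C. fls_const (a b x) * x)" for b
  have pC: "p b \<in> vs.span C" for b
    unfolding p_def by (intro vs.span_sum vs.span_scale vs.span_base)
  have zero: "\<forall>b\<in>B. c b = 0" if s: "(\<Sum>b\<in>B. fls_const (c b) * p b) = 0" for c
  proof -
    have "(\<Sum>b\<in>B. fls_const (c b) * (b - p b)) \<in> W"
      using a unfolding p_def by (intro vs.subspace_sum[OF subW] vs.subspace_scale[OF subW]) auto
    also have "(\<Sum>b\<in>B. fls_const (c b) * (b - p b)) = (\<Sum>b\<in>B. fls_const (c b) * b)"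
      using s by (simp add: right_diff_distrib sum_subtractf)
    finally show ?thesis
      using B unfolding quotient_basis_def by blast
  qed
  have inj: "inj_on p B"
  proof (rule inj_onI, rule ccontr)
    fix x y assume xy: "x \<in> B" "y \<in> B" "p x = p y" "x \<noteq> y"
    define c :: "'k fls \<Rightarrow> 'k" where "c = (\<lambda>b. if b = x then 1 else if b = y then - 1 else 0)"
    have m1: "fls_const (- 1 :: 'k) = - 1"
      by (intro fls_eqI) simp
    have "(\<Sum>b\<in>B. fls_const (c b) * p b) = (\<Sum>b\<in>{x, y}. fls_const (c b) * p b)"
      using xy finB by (intro sum.mono_neutral_right) (auto simp: c_def)
    also have "\<dots> = 0"
      using xy by (simp add: c_def m1)
    finally have "c x = 0"
      using zero xy by blast
    then show False by (simp add: c_def)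
  qed
  have "vs.independent (p ` B)"
  proof (rule vs.independent_if_scalars_zero)
    fix f x
    assume f: "(\<Sum>y\<in>p ` B. fls_const (f y) * y) = 0" and x: "x \<in> p ` B"
    have "(\<Sum>b\<in>B. fls_const (f (p b)) * p b) = 0"
      using f by (simp add: sum.reindex[OF inj])
    from zero[OF this] x show "f x = 0" by auto
  qed (use finB in simp)
  then have "card (p ` B) \<le> card C"
    using vs.independent_span_bound[OF finC] pC by blast
  then show ?thesis
    by (simp add: card_image[OF inj])
qed

lemma quotient_dim_eq:
  assumes "submodule (range fls_const) W" "quotient_basis V W B"
  shows "quotient_dim V W = card B"
  unfolding quotient_dim_def
  using assms quotient_basis_card_le by (intro the_equality) (blast intro: le_antisym)+


subsection \<open>Invariants of the semigroup ring\<close>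

text \<open>
  Below, \<open>A\<close> is the minimal generating set of \<open>H\<close>, so \<open>Min A\<close> is the smallest generator and
  \<open>card A\<close> is the number of generators.
\<close>

definition multiplicity_of :: "nat set \<Rightarrow> nat" where
  "multiplicity_of A = Min A"

definition embedding_dim :: "nat set \<Rightarrow> nat" where
  "embedding_dim A = card A"

definition minimal_multiplicity :: "nat set \<Rightarrow> bool" where
  "minimal_multiplicity A \<longleftrightarrow> multiplicity_of A = embedding_dim A"

text \<open>In both invariants \<open>e\<close> is the multiplicity of \<open>R\<close>.\<close>

definition reduced_type :: "'k::field fls set \<Rightarrow> nat \<Rightarrow> nat" where
  "reduced_type R e = quotient_dim (conductor R + (fls_X ^ e) *o R) ((fls_X ^ e) *o R)"

definition cm_type :: "'k::field fls set \<Rightarrow> nat \<Rightarrow> nat" where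
  "cm_type R e =
     quotient_dim (R \<inter> colon ((fls_X ^ e) *o R) (max_ideal R)) ((fls_X ^ e) *o R)"

definition maximal_reduced_type :: "'k::field fls set \<Rightarrow> nat \<Rightarrow> bool" where
  "maximal_reduced_type R e \<longleftrightarrow> reduced_type R e = cm_type R e"

end

theory Submission
  imports Defs
begin

text \<open>
  Let \<open>F\<close> be the Frobenius number of \<open>H\<close> and \<open>e\<close> its multiplicity. The series with exponents in
  \<open>K = {y. F - y \<notin> H}\<close> form a canonical module, and every canonical module is a multiple of it. If
  the trace ideal equals the conductor, then \<open>K + K\<close> is all of \<open>\<nat>\<close>: were \<open>n\<close> not such a sum, then
  multiplication by \<open>t^(F - n)\<close> would map the canonical module into \<open>R\<close> and \<open>1\<close> outside the
  conductor. In particular the elements of \<open>K\<close> below \<open>e\<close>, whose number is the reduced type \<open>s\<close>, have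
  pairwise sums covering \<open>{0..<e}\<close>. The type \<open>r\<close> counts Apery elements other than \<open>0\<close>, so
  \<open>r < e\<close>. If \<open>s < r \<le> 4\<close>, then covering forces \<open>e \<le> 1, 3, 5\<close> for \<open>s = 1, 2, 3\<close>, which leaves only
  \<open>r = 4\<close>, \<open>e = 5\<close>; but \<open>r = e - 1\<close> implies minimal multiplicity.
\<close>

subsection \<open>Series with prescribed support\<close>

text \<open>Negative exponents occur, for instance in inverses of monomials.
  \<open>fls_shift\<close> lowers exponents, hence the sign.\<close>

definition fls_monom :: "int \<Rightarrow> 'k::field fls" where
  "fls_monom n = fls_shift (- n) 1"

lemma fls_monom_nth [simp]: "fls_nth (fls_monom m) n = (if n = m then 1 else 0)"
  by (auto simp: fls_monom_def)

lemma fls_monom_mult_nth [simp]: "fls_nth (fls_monom m * f) n = fls_nth f (n - m)"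
  by (simp add: fls_monom_def fls_X_intpow_times_conv_shift)

lemma fls_mult_monom_nth [simp]: "fls_nth (f * fls_monom m) n = fls_nth f (n - m)"
  by (simp add: mult.commute[of f])

lemma fls_monom_0 [simp]: "fls_monom 0 = 1"
  by (simp add: fls_monom_def)

lemma fls_monom_mult: "fls_monom m * fls_monom n = fls_monom (m + n)"
  by (intro fls_eqI) auto

lemma fls_X_power_eq_monom: "fls_X ^ n = fls_monom (int n)"
  by (intro fls_eqI) simp

lemma inj_fls_monom: "inj (fls_monom :: int \<Rightarrow> 'k::field fls)"
proof (rule injI)
  fix m n :: int
  assume "(fls_monom m :: 'k fls) = fls_monom n"
  then have "fls_nth (fls_monom m :: 'k fls) m = fls_nth (fls_monom n :: 'k fls) m"
    by simp
  then show "m = n"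
    by (simp split: if_splits)
qed

text \<open>\<open>R\<close>, its maximal ideal, its conductor and the monomial canonical module all
  have this form, which turns questions about colons, sums and quotient dimensions into questions
  about sets of integers.\<close>

definition supported :: "int set \<Rightarrow> 'k::field fls set" where
  "supported E = {f. \<forall>n. fls_nth f n \<noteq> 0 \<longrightarrow> n \<in> E}"

lemma supportedI: "(\<And>n. fls_nth f n \<noteq> 0 \<Longrightarrow> n \<in> E) \<Longrightarrow> f \<in> supported E"
  and supportedD: "f \<in> supported E \<Longrightarrow> fls_nth f n \<noteq> 0 \<Longrightarrow> n \<in> E"
  by (auto simp: supported_def)

lemma fls_monom_in_supported [simp]: "fls_monom n \<in> supported E \<longleftrightarrow> n \<in> E"
  by (auto simp: supported_def)

lemma supported_mono: "D \<subseteq> E \<Longrightarrow> supported D \<subseteq> supported E"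
  by (auto simp: supported_def)

lemma zero_in_supported [simp]: "0 \<in> supported E"
  by (auto simp: supported_def)

lemma one_in_supported [simp]: "1 \<in> supported E \<longleftrightarrow> 0 \<in> E"
  by (auto simp: supported_def)

lemma supported_add: "f \<in> supported E \<Longrightarrow> g \<in> supported E \<Longrightarrow> f + g \<in> supported E"
  unfolding supported_def by simp (metis add_0)

lemma supported_diff: "f \<in> supported E \<Longrightarrow> g \<in> supported E \<Longrightarrow> f - g \<in> supported E"
  unfolding supported_def by simp metis

lemma fls_mult_nth_nonzeroE:
  fixes f g :: "'k::field fls"
  assumes "fls_nth (f * g) n \<noteq> 0"
  obtains i where "fls_nth f i \<noteq> 0" "fls_nth g (n - i) \<noteq> 0"
proof -
  have "\<exists>i. fls_nth f i * fls_nth g (n - i) \<noteq> 0"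
    using assms unfolding fls_times_nth(2) by (meson sum.neutral)
  then show thesis using that by auto
qed

lemma supported_mult:
  fixes f g :: "'k::field fls"
  assumes "f \<in> supported D" "g \<in> supported E" "\<And>i j. i \<in> D \<Longrightarrow> j \<in> E \<Longrightarrow> i + j \<in> G"
  shows "f * g \<in> supported G"
proof (rule supportedI)
  fix n assume "fls_nth (f * g) n \<noteq> 0"
  then obtain i where "fls_nth f i \<noteq> 0" "fls_nth g (n - i) \<noteq> 0"
    by (rule fls_mult_nth_nonzeroE)
  then show "n \<in> G"
    using assms(3)[of i "n - i"] supportedD[OF assms(1)] supportedD[OF assms(2)] by simp
qed

lemma submodule_supported:
  assumes "\<And>i j. i \<in> D \<Longrightarrow> j \<in> E \<Longrightarrow> i + j \<in> E"
  shows "submodule (supported D) (supported E :: 'k::field fls set)"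
  unfolding submodule_def
  by (auto intro: supported_add supported_mult[where D = D and E = E] assms)

lemma submodule_const_supported: "submodule (range fls_const) (supported E :: 'k::field fls set)"
  unfolding submodule_def using supported_add by (auto simp: supported_def)

lemma semigroup_ring_eq_supported: "semigroup_ring H = supported (int ` H)"
proof (intro equalityI subsetI)
  fix f :: "'k::field fls" assume "f \<in> semigroup_ring H"
  then obtain g where g: "f = fps_to_fls g" "\<And>n. fps_nth g n \<noteq> 0 \<Longrightarrow> n \<in> H"
    unfolding semigroup_ring_def by auto
  show "f \<in> supported (int ` H)"
    by (rule supportedI) (use g in \<open>auto simp: image_iff split: if_splits intro!: bexI[of _ "nat _"]\<close>)
next
  fix f :: "'k::field fls" assume f: "f \<in> supported (int ` H)"
  have "0 \<le> fls_subdegree f"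
    using supportedD[OF f] by (intro fls_subdegree_ge0I) force
  then have "f = fps_to_fls (fls_regpart f)"
    by simp
  moreover have "\<forall>n. fps_nth (fls_regpart f) n \<noteq> 0 \<longrightarrow> n \<in> H"
    using supportedD[OF f] by fastforce
  ultimately show "f \<in> semigroup_ring H"
    unfolding semigroup_ring_def by blast
qed

lemma power_series_ring_eq_supported: "power_series_ring = supported {0..}"
proof -
  have "power_series_ring = (semigroup_ring UNIV :: 'k::field fls set)"
    by (simp add: power_series_ring_def semigroup_ring_def)
  also have "range int = {0..}"
    by (auto simp: image_iff dest: zero_le_imp_eq_int)
  then have "(semigroup_ring UNIV :: 'k::field fls set) = supported {0..}"
    by (simp add: semigroup_ring_eq_supported)
  finally show ?thesis .
qed

lemma monom_times_supported:
  "fls_monom m *o supported E = (supported ((+) m ` E) :: 'k::field fls set)"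
proof (intro equalityI subsetI)
  fix f :: "'k fls" assume "f \<in> fls_monom m *o supported E"
  then obtain g where g: "g \<in> supported E" "f = fls_monom m * g"
    by (auto simp: elt_set_times_def)
  show "f \<in> supported ((+) m ` E)"
  proof (rule supportedI)
    fix n assume "fls_nth f n \<noteq> 0"
    then have "n - m \<in> E" using g supportedD by fastforce
    then show "n \<in> (+) m ` E" by (auto intro: image_eqI[of _ _ "n - m"])
  qed
next
  fix f :: "'k fls" assume f: "f \<in> supported ((+) m ` E)"
  have "fls_monom (- m) * f \<in> supported E"
    using supportedD[OF f] by (intro supportedI) force
  moreover have "f = fls_monom m * (fls_monom (- m) * f)"
    by (simp add: mult.assoc[symmetric] fls_monom_mult)
  ultimately show "f \<in> fls_monom m *o supported E"
    unfolding elt_set_times_def by blast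
qed

lemma fls_restrict:
  fixes f :: "'k::field fls"
  obtains g where "\<And>n. fls_nth g n = (if n \<in> E then fls_nth f n else 0)"
proof -
  obtain N where "\<forall>n<N. fls_nth f n = 0"
    by (rule fls_nth_vanishes_belowE)
  then have "\<exists>N. \<forall>n<N. (\<lambda>n. if n \<in> E then fls_nth f n else 0) n = 0"
    by auto
  from nth_Abs_fls_ex_lower_bound[OF this] that show thesis
    by blast
qed

lemma supported_plus_supported:
  "supported D + supported E = (supported (D \<union> E) :: 'k::field fls set)"
proof (intro equalityI subsetI)
  fix f :: "'k fls" assume "f \<in> supported D + supported E"
  then show "f \<in> supported (D \<union> E)"
    by (auto elim!: set_plus_elim intro!: supported_add dest: supported_mono[THEN subsetD, rotated])
next
  fix f :: "'k fls" assume f: "f \<in> supported (D \<union> E)"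
  obtain g where g: "\<And>n. fls_nth g n = (if n \<in> D then fls_nth f n else 0)"
    using fls_restrict[of D f] by blast
  have "g \<in> supported D"
    by (auto simp: supported_def g)
  moreover have "f - g \<in> supported E"
    using supportedD[OF f] by (auto simp: supported_def g)
  ultimately have "g + (f - g) \<in> supported D + supported E"
    by (rule set_plus_intro)
  then show "f \<in> supported D + supported E" by simp
qed

lemma fls_sum_nth: "fls_nth (\<Sum>b\<in>B. f b) n = (\<Sum>b\<in>B. fls_nth (f b) n)"
  by (induction B rule: infinite_finite_induct) auto

lemma fls_sum_monom_nth:
  assumes "finite B"
  shows "fls_nth (\<Sum>m\<in>B. fls_const (c m) * fls_monom m) n = (if n \<in> B then c n else 0)"
  using assms by (simp add: fls_sum_nth if_distrib[of "\<lambda>x. _ * x"] sum.delta cong: if_cong)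

text \<open>The monomials with exponents in \<open>E - D\<close> represent a basis of the
  quotient.\<close>

lemma quotient_dim_supported:
  assumes "finite (E - D)" "D \<subseteq> E"
  shows "quotient_dim (supported E) (supported D :: 'k::field fls set) = card (E - D)"
proof -
  let ?B = "(fls_monom :: int \<Rightarrow> 'k fls) ` (E - D)"
  have inj: "inj_on (fls_monom :: int \<Rightarrow> 'k fls) (E - D)"
    using inj_fls_monom inj_on_subset by blast
  have sum_eq: "(\<Sum>b\<in>?B. fls_const (c b) * b)
      = (\<Sum>m\<in>E - D. fls_const (c (fls_monom m)) * fls_monom m)" for c :: "'k fls \<Rightarrow> 'k"
    by (simp add: sum.reindex[OF inj])
  have "quotient_basis (supported E) (supported D :: 'k fls set) ?B"
    unfolding quotient_basis_def
  proof (intro conjI ballI allI impI)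
    fix v :: "'k fls" assume v: "v \<in> supported E"
    \<comment> \<open>\<open>quotient_basis\<close> indexes coefficients by the basis series
      themselves; the subdegree recovers the exponent of a monomial.\<close>
    define c where "c b = fls_nth v (fls_subdegree b)" for b :: "'k fls"
    have c: "c (fls_monom m) = fls_nth v m" for m
      by (simp add: c_def fls_monom_def)
    have "v - (\<Sum>b\<in>?B. fls_const (c b) * b) \<in> supported D"
      unfolding sum_eq c using supportedD[OF v] assms(1)
      by (auto simp: supported_def fls_sum_monom_nth split: if_splits)
    then show "\<exists>c. v - (\<Sum>b\<in>?B. fls_const (c b) * b) \<in> supported D"
      by blast
  next
    fix c :: "'k fls \<Rightarrow> 'k" and b
    assume s: "(\<Sum>b\<in>?B. fls_const (c b) * b) \<in> supported D" and "b \<in> ?B"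
    then obtain m where m: "m \<in> E - D" "b = fls_monom m" by auto
    have "fls_nth (\<Sum>b\<in>?B. fls_const (c b) * b) m = c b"
      unfolding sum_eq using m assms(1) by (simp add: fls_sum_monom_nth)
    then show "c b = 0"
      using supportedD[OF s, of m] m by auto
  qed (use assms in auto)
  then have "quotient_dim (supported E) (supported D :: 'k fls set) = card ?B"
    by (rule quotient_dim_eq[OF submodule_const_supported])
  then show ?thesis
    by (simp add: card_image[OF inj])
qed

subsection \<open>Fractional ideals\<close>

lemma submodule_hull: "submodule R (submodule R hull X)"
  by (rule hull_in) (fastforce simp: submodule_def)

lemma submodule_colon: "submodule R M \<Longrightarrow> submodule R (colon M X)"
  unfolding submodule_def colon_def by (auto simp: distrib_right mult.assoc)

text \<open>For fixed \<open>z\<close>, the series \<open>y\<close> with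
  \<open>z * y \<in> M\<close> form a submodule, so testing generators is enough.\<close>

lemma colon_hull:
  assumes "submodule R M"
  shows "colon M (submodule R hull X) = colon M X"
proof
  show "colon M (submodule R hull X) \<subseteq> colon M X"
    by (auto simp: colon_def intro: hull_inc)
  show "colon M X \<subseteq> colon M (submodule R hull X)"
  proof
    fix z assume z: "z \<in> colon M X"
    have "submodule R {y. z * y \<in> M}"
      using assms unfolding submodule_def by (auto simp: distrib_left mult.left_commute)
    moreover have "X \<subseteq> {y. z * y \<in> M}"
      using z by (auto simp: colon_def)
    ultimately have "submodule R hull X \<subseteq> {y. z * y \<in> M}"
      by (rule hull_minimal[rotated])
    then show "z \<in> colon M (submodule R hull X)"
      by (auto simp: colon_def)
  qed
qed

text \<open>A basis of \<open>I\<close> stays independent when \<open>z\<close> is added, so the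
  values 0 on the basis and 1 at \<open>z\<close> extend linearly.\<close>

lemma fls_separating_functional:
  fixes I :: "'k::field fls set"
  assumes "submodule (range fls_const) I" "z \<notin> I"
  obtains g :: "'k fls \<Rightarrow> 'k" where
    "\<And>x y. g (x + y) = g x + g y" "\<And>c x. g (fls_const c * x) = c * g x"
    "\<And>y. y \<in> I \<Longrightarrow> g y = 0" "g z = 1"
proof -
  interpret vs: vector_space "\<lambda>c f. fls_const c * f :: 'k fls"
    by (rule vector_space_fls)
  interpret k: vector_space "(*) :: 'k \<Rightarrow> 'k \<Rightarrow> 'k"
    by unfold_locales (auto simp: algebra_simps)
  interpret vp: vector_space_pair "\<lambda>c f. fls_const c * f :: 'k fls" "(*) :: 'k \<Rightarrow> 'k \<Rightarrow> 'k" ..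
  have sub: "vs.subspace I"
    using assms(1) unfolding submodule_def vs.subspace_def by blast
  obtain B where B: "B \<subseteq> I" "vs.independent B" "I \<subseteq> vs.span B"
    by (rule vs.maximal_independent_subset)
  have I: "vs.span B = I"
    using B sub vs.span_minimal by blast
  have "vs.independent (insert z B)"
    using assms(2) B I by (intro vs.independent_insertI) auto
  then obtain g where g: "Vector_Spaces.linear (\<lambda>c f. fls_const c * f) (*) g"
      "\<forall>x\<in>insert z B. g x = (if x = z then 1 else 0 :: 'k)"
    using vp.linear_independent_extend[of "insert z B" "\<lambda>x. if x = z then 1 else 0"] by blast
  interpret g: Vector_Spaces.linear "\<lambda>c f. fls_const c * f" "(*)" g by (rule g(1))
  have "g y = 0" if "y \<in> I" for y
  proof (rule g.eq_0_on_span)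
    show "y \<in> vs.span B" using that I by simp
    show "g x = 0" if "x \<in> B" for x
      using g(2) that B(1) assms(2) by auto
  qed
  with g(2) show thesis
    by (intro that[of g]) (auto simp: g.add g.scale)
qed

subsection \<open>The canonical module of a numerical semigroup ring\<close>

text \<open>
  \<open>S\<close> is the semigroup and \<open>F\<close> its Frobenius number, both as integers so that differences of
  exponents do not truncate.
\<close>

locale numerical_semigroup_fls =
  fixes S :: "int set" and F :: int and R :: "'k::field fls set"
  assumes R_def: "R = supported S"
    and zero_in: "0 \<in> S"
    and add_in: "m \<in> S \<Longrightarrow> n \<in> S \<Longrightarrow> m + n \<in> S"
    and nonneg: "n \<in> S \<Longrightarrow> 0 \<le> n"
    and Frobenius_notin: "F \<notin> S"
    and gt_Frobenius: "F < n \<Longrightarrow> n \<in> S"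
    and Frobenius_pos: "0 < F"
begin

definition K :: "int set" where
  "K = {y. F - y \<notin> S}"

lemma K_nonneg: "y \<in> K \<Longrightarrow> 0 \<le> y"
  using gt_Frobenius[of "F - y"] by (force simp: K_def)

lemma zero_in_K: "0 \<in> K"
  using Frobenius_notin by (simp add: K_def)

lemma K_add: "h \<in> S \<Longrightarrow> y \<in> K \<Longrightarrow> h + y \<in> K"
  using add_in[of h "F - (h + y)"] by (auto simp: K_def)

lemma submodule_const:
  assumes "submodule R I"
  shows "submodule (range fls_const) I"
proof -
  have "range fls_const \<subseteq> R"
    using zero_in by (auto simp: R_def supported_def split: if_splits)
  then show ?thesis
    using assms unfolding submodule_def by blast
qed

lemma one_in_R: "1 \<in> R"
  by (simp add: R_def zero_in)

lemma fractional_ideal_supported: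
  assumes "\<And>i j. i \<in> S \<Longrightarrow> j \<in> E \<Longrightarrow> i + j \<in> E" "0 \<in> E" "\<And>n. n \<in> E \<Longrightarrow> 0 \<le> n"
  shows "fractional_ideal R (supported E)"
  unfolding fractional_ideal_def
\<comment> \<open>The common denominator \<open>t^(F + 1)\<close> pushes nonnegative exponents above
  \<open>F\<close>, hence into \<open>S\<close>.\<close>
proof (intro conjI bexI[of _ "fls_monom (F + 1)"] ballI)
  show "submodule R (supported E)"
    unfolding R_def by (rule submodule_supported) (rule assms)
  show "supported E \<noteq> {0 :: 'k fls}"
    using one_in_supported[where 'a = 'k, of E] assms(2) by (metis singletonD zero_neq_one)
  fix f :: "'k fls" assume f: "f \<in> supported E"
  show "fls_monom (F + 1) * f \<in> R"
    unfolding R_def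
    by (rule supportedI) (use supportedD[OF f] assms(3) in \<open>force intro: gt_Frobenius\<close>)
next
  have "fls_monom (F + 1) \<noteq> (0 :: 'k fls)"
    by (metis fls_monom_nth fls_zero_nth zero_neq_one)
  then show "fls_monom (F + 1) \<in> R - {0 :: 'k fls}"
    by (simp add: R_def gt_Frobenius)
qed

lemma fractional_ideal_R: "fractional_ideal R R"
  using fractional_ideal_supported[of S] zero_in add_in nonneg
  by (simp add: R_def)

lemma fractional_ideal_K: "fractional_ideal R (supported K)"
  by (rule fractional_ideal_supported) (auto intro: K_add zero_in_K K_nonneg)

section \<open>Units, the maximal ideal and the conductor\<close>

lemma ex_inverse_in_R:
  assumes "f \<in> R" "fls_nth f 0 \<noteq> 0"
  shows "\<exists>g\<in>R. f * g = 1"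
proof
  have f0: "f \<noteq> 0"
    using assms(2) by auto
  have "fls_nth f n = 0" if "n < 0" for n
    using supportedD[OF assms(1)[unfolded R_def], of n] nonneg[of n] that by auto
  then have sd: "fls_subdegree f = 0"
    using assms(2) by (intro fls_subdegree_eqI) auto
  show inv: "f * inverse f = 1"
    using f0 by simp
  \<comment> \<open>The part \<open>h\<close> of the Laurent inverse with exponents in
    \<open>S\<close> is all of it. Otherwise the lowest exponent of \<open>d\<close> lies outside
    \<open>S\<close>, yet it is also the lowest exponent of \<open>f * d = 1 - f * h\<close>, an
    element of \<open>R\<close>.\<close>
  obtain h where h: "\<And>n. fls_nth h n = (if n \<in> S then fls_nth (inverse f) n else 0)"
    using fls_restrict[of S "inverse f"] by blast
  have hR: "h \<in> R"
    by (auto simp: R_def supported_def h)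
  define d where "d = inverse f - h"
  have "d = 0"
  proof (rule ccontr)
    assume "d \<noteq> 0"
    define n where "n = fls_subdegree d"
    have dn: "fls_nth d n \<noteq> 0"
      using \<open>d \<noteq> 0\<close> by (simp add: n_def)
    then have "n \<notin> S"
      by (auto simp: d_def h)
    have "f * d = 1 - f * h"
      by (simp add: d_def right_diff_distrib inv)
    also have "\<dots> \<in> R"
      using one_in_R supported_mult[OF assms(1)[unfolded R_def] hR[unfolded R_def] add_in]
      unfolding R_def by (rule supported_diff)
    finally have "f * d \<in> R" .
    moreover have "fls_subdegree (f * d) = n"
      using \<open>d \<noteq> 0\<close> f0 sd by (simp add: n_def)
    then have "fls_nth (f * d) n \<noteq> 0"
      using \<open>d \<noteq> 0\<close> f0 nth_fls_subdegree_nonzero[of "f * d"] by simp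
    ultimately show False
      using \<open>n \<notin> S\<close> supportedD unfolding R_def by blast
  qed
  then show "inverse f \<in> R"
    using hR by (simp add: d_def)
qed

lemma max_ideal_eq: "max_ideal R = supported (S - {0})"
proof (intro equalityI subsetI)
  fix f :: "'k fls" assume "f \<in> max_ideal R"
  then have "f \<in> R" "fls_nth f 0 = 0"
    using ex_inverse_in_R by (auto simp: max_ideal_def)
  then show "f \<in> supported (S - {0})"
    by (auto simp: R_def supported_def)
next
  fix f :: "'k fls" assume f: "f \<in> supported (S - {0})"
  have "f * g \<noteq> 1" if g: "g \<in> R" for g
  proof -
    have "f * g \<in> supported {1..}"
    proof (rule supported_mult[OF f g[unfolded R_def]])
      fix i j assume "i \<in> S - {0}" "j \<in> S"
      then show "i + j \<in> {1..}"
        using nonneg[of i] nonneg[of j] by auto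
    qed
    then show ?thesis by auto
  qed
  moreover have "f \<in> R"
    using f supported_mono[of "S - {0}" S] by (auto simp: R_def)
  ultimately show "f \<in> max_ideal R"
    by (auto simp: max_ideal_def)
qed

text \<open>A nonzero coefficient at some \<open>n \<le> F\<close> is moved by the power series
  \<open>t^(F - n)\<close> to the exponent \<open>F\<close>, which is missing from
  \<open>S\<close>.\<close>

lemma conductor_eq: "conductor R = supported {F<..}"
proof (intro equalityI subsetI)
  fix f :: "'k fls" assume "f \<in> conductor R"
  then have f: "f * g \<in> R" if "g \<in> supported {0..}" for g
    using that by (auto simp: conductor_def colon_def power_series_ring_eq_supported)
  show "f \<in> supported {F<..}"
  proof (rule supportedI, rule ccontr)
    fix n assume n: "fls_nth f n \<noteq> 0" "n \<notin> {F<..}"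
    have "f * fls_monom (F - n) \<in> R"
      by (rule f) (use n in auto)
    moreover have "fls_nth (f * fls_monom (F - n)) F \<noteq> 0"
      using n by simp
    ultimately show False
      using supportedD Frobenius_notin unfolding R_def by blast
  qed
next
  fix f :: "'k fls" assume f: "f \<in> supported {F<..}"
  have "f * g \<in> R" if "g \<in> supported {0..}" for g
    unfolding R_def by (rule supported_mult[OF f that]) (auto intro: gt_Frobenius)
  then show "f \<in> conductor R"
    by (auto simp: conductor_def colon_def power_series_ring_eq_supported)
qed

text \<open>
  The coefficient of \<open>t\<^sup>F\<close> is a dualizing functional: \<open>colon (supported K) I\<close> is the orthogonal
  complement of \<open>I\<close> under the pairing that sends \<open>x\<close>, \<open>y\<close> to that coefficient of \<open>x * y\<close>.
\<close>

lemma colon_K_eq: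
  assumes "submodule R I"
  shows "colon (supported K) I = {x. \<forall>y\<in>I. fls_nth (x * y) F = 0}"
proof (intro equalityI subsetI CollectI ballI)
  fix x y assume "x \<in> colon (supported K) I" "y \<in> I"
  then have "x * y \<in> supported K" by (auto simp: colon_def)
  then show "fls_nth (x * y) F = 0"
    using supportedD zero_in by (fastforce simp: K_def)
next
  fix x assume x: "x \<in> {x. \<forall>y\<in>I. fls_nth (x * y) F = 0}"
  have "x * y \<in> supported K" if y: "y \<in> I" for y
  proof (rule supportedI)
    fix n assume n: "fls_nth (x * y) n \<noteq> 0"
    show "n \<in> K"
    proof (rule ccontr)
      \<comment> \<open>Now \<open>F - n \<in> S\<close>, so multiplication by
        \<open>t^(F - n)\<close> keeps \<open>y\<close> in \<open>I\<close> and moves the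
        coefficient at \<open>n\<close> to \<open>F\<close>.\<close>
      assume "n \<notin> K"
      then have "fls_monom (F - n) \<in> R"
        by (simp add: R_def K_def)
      then have "fls_monom (F - n) * y \<in> I"
        using assms y by (auto simp: submodule_def)
      then have "fls_nth (x * (fls_monom (F - n) * y)) F = 0"
        using x by blast
      then have "fls_nth (fls_monom (F - n) * (x * y)) F = 0"
        by (simp only: mult.left_commute[of x])
      then show False using n by simp
    qed
  qed
  then show "x \<in> colon (supported K) I"
    by (auto simp: colon_def)
qed

text \<open>The quotient of \<open>g\<close> by \<open>f\<close> has order above \<open>F\<close>,
  so it lies in \<open>R\<close>.\<close>

lemma high_order_in_submodule:
  assumes "submodule R I" "f \<in> I" "f \<noteq> 0" "g \<in> supported {F + fls_subdegree f<..}"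
  shows "g \<in> I"
proof (cases "g = 0")
  case True
  then show ?thesis using assms(1) by (simp add: submodule_def)
next
  case False
  have "F + fls_subdegree f < fls_subdegree g"
    using supportedD[OF assms(4)] False by force
  then have "F < fls_subdegree (g * inverse f)"
    using False assms(3) by (simp add: fls_inverse_subdegree)
  then have "F < n" if "fls_nth (g * inverse f) n \<noteq> 0" for n
    using that fls_subdegree_leI[of "g * inverse f" n] by linarith
  then have "g * inverse f \<in> R"
    unfolding R_def by (intro supportedI gt_Frobenius)
  then have "(g * inverse f) * f \<in> I"
    using assms(1,2) by (auto simp: submodule_def)
  then show ?thesis
    using assms(3) by (simp add: mult.assoc)
qed

text \<open>Reflexivity says that \<open>I\<close> is its own double orthogonal complement. A
  functional that vanishes on \<open>I\<close> but not at \<open>z\<close> ignores all high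
  exponents, since \<open>I\<close> contains every series of high order. Hence it is the pairing
  with some series \<open>x\<close>, and this \<open>x\<close> keeps \<open>z\<close> out of the
  double colon.\<close>

lemma canonical_module_K: "canonical_module R (supported K)"
  unfolding canonical_module_def
proof (intro conjI allI impI)
  show "fractional_ideal R (supported K)"
    by (rule fractional_ideal_K)
  fix I :: "'k fls set" assume I: "fractional_ideal R I"
  then have sub: "submodule R I" and "I \<noteq> {0}"
    by (auto simp: fractional_ideal_def)
  then obtain f where f: "f \<in> I" "f \<noteq> 0"
    by (auto simp: submodule_def)
  define N where "N = F + fls_subdegree f"
  have high: "g \<in> I" if "g \<in> supported {N<..}" for g
    using high_order_in_submodule[OF sub f] that by (simp add: N_def)
  have sub': "submodule R (colon (supported K) I)"
    using fractional_ideal_K by (intro submodule_colon) (simp add: fractional_ideal_def)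
  show "colon (supported K) (colon (supported K) I) = I"
  proof (rule ccontr)
    have "I \<subseteq> colon (supported K) (colon (supported K) I)"
      by (auto simp: colon_def mult.commute)
    moreover assume "colon (supported K) (colon (supported K) I) \<noteq> I"
    ultimately obtain z where z: "z \<in> colon (supported K) (colon (supported K) I)" "z \<notin> I"
      by blast
    obtain g :: "'k fls \<Rightarrow> 'k" where g:
      "\<And>x y. g (x + y) = g x + g y" "\<And>c x. g (fls_const c * x) = c * g x"
      "\<And>y. y \<in> I \<Longrightarrow> g y = 0" "g z = 1"
      using fls_separating_functional[OF submodule_const[OF sub] z(2)] by blast
    \<comment> \<open>Chosen so that the coefficient of \<open>t^F\<close> in \<open>x * t^n\<close>
      is the value of \<open>g\<close> at \<open>t^n\<close>.\<close>
    define x where "x = Abs_fls (\<lambda>m. g (fls_monom (F - m)))"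
    have g0: "g (fls_monom n) = 0" if "N < n" for n
      using g(3) high that by simp
    then have "\<forall>m < F - N. g (fls_monom (F - m)) = 0"
      by simp
    then have x: "fls_nth x m = g (fls_monom (F - m))" for m
      unfolding x_def by (rule nth_Abs_fls_lower_bound)
    have g_eq: "fls_nth (x * y) F = g y" for y
    proof -
      obtain M where M: "\<forall>n<M. fls_nth y n = 0"
        by (rule fls_nth_vanishes_belowE)
      define p where "p B = (\<Sum>m\<in>B. fls_const (fls_nth y m) * fls_monom m)" for B :: "int set"
      have p: "fls_nth (x * p B) F = g (p B)" if "finite B" for B
        using that
      proof (induction B)
        case empty
        have "g 0 = 0"
          using g(2)[of 0 0] by simp
        then show ?case by (simp add: p_def)
      next
        case (insert m B)
        have "x * p (insert m B) = fls_const (fls_nth y m) * (x * fls_monom m) + x * p B"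
          using insert by (simp add: p_def distrib_left mult.left_commute)
        moreover have "p (insert m B) = fls_const (fls_nth y m) * fls_monom m + p B"
          using insert by (simp add: p_def)
        ultimately show ?case
          using insert.IH by (simp add: g x)
      qed
      \<comment> \<open>\<open>q\<close> is \<open>y\<close> cut off after exponent
        \<open>N\<close>. The rest lies in \<open>I\<close>, where \<open>g\<close> vanishes, and it
        contributes nothing at \<open>F\<close> because \<open>x\<close> has no exponents below
        \<open>F - N\<close>.\<close>
      define q where "q = p {M..N}"
      have high_part: "y - q \<in> supported {N<..}"
        using M by (auto simp: q_def p_def supported_def fls_sum_monom_nth not_le split: if_splits)
      have "x \<in> supported {F - N..}"
        using g0 by (auto simp: supported_def x intro!: leI)
      then have "x * (y - q) \<in> supported {F<..}"
        using high_part by (rule supported_mult) auto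
      then have "fls_nth (x * (y - q)) F = 0"
        using supportedD by force
      moreover have "g y = g q"
        using g(1)[of "y - q" q] g(3) high[OF high_part] by simp
      ultimately show ?thesis
        using p[of "{M..N}"] by (simp add: right_diff_distrib q_def)
    qed
    then have "x \<in> colon (supported K) I"
      unfolding colon_K_eq[OF sub] by (simp add: g(3))
    then have "fls_nth (z * x) F = 0"
      using z(1) unfolding colon_K_eq[OF sub'] by simp
    then show False
      using g_eq[of z] g(4) by (simp add: mult.commute)
  qed
qed

section \<open>Uniqueness of the canonical module, and its trace\<close>

lemma R_subset_K: "R \<subseteq> supported K"
  unfolding R_def using K_add[OF _ zero_in_K] by (intro supported_mono) auto

text \<open>As \<open>1 \<in> R\<close>, the inner colon in \<open>colon W (colon W R)\<close> is
  \<open>W\<close>; then \<open>R\<close> is reflexive.\<close>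

lemma canonical_colon_self:
  assumes "canonical_module R W"
  shows "colon W W = R"
proof -
  have sub: "submodule R W"
    using assms by (simp add: canonical_module_def fractional_ideal_def)
  have "colon W R = W"
  proof (intro equalityI subsetI)
    fix x assume "x \<in> colon W R"
    then have "x * 1 \<in> W"
      using one_in_R unfolding colon_def by blast
    then show "x \<in> W" by simp
  next
    fix x assume "x \<in> W"
    then have "r * x \<in> W" if "r \<in> R" for r
      using sub that by (simp add: submodule_def)
    then show "x \<in> colon W R"
      by (simp add: colon_def mult.commute)
  qed
  then show ?thesis
    using assms fractional_ideal_R unfolding canonical_module_def by metis
qed

text \<open>
  The fractional ideals \<open>colon W (supported K)\<close> and \<open>colon (supported K) W\<close> are inverse to each
  other because their product is reflexive with respect to \<open>W\<close>; as \<open>R\<close> is local, some product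
  \<open>i * j\<close> of their elements is a unit, and then \<open>j\<close> maps \<open>W\<close> onto the monomial canonical module.
\<close>

lemma canonical_module_scaling:
  assumes W: "canonical_module R W"
  obtains j w where "w \<in> W" "j * w = 1" "\<And>v. v \<in> W \<Longrightarrow> j * v \<in> supported K"
proof -
  have fW: "fractional_ideal R W" and sW: "submodule R W"
    using W by (auto simp: canonical_module_def fractional_ideal_def)
  define I where "I = colon W (supported K)"
  define J where "J = colon (supported K) W"
  define P where "P = submodule R hull {i * j |i j. i \<in> I \<and> j \<in> J}"
  have WI: "colon W I = supported K"
    using W fractional_ideal_K by (simp add: I_def canonical_module_def)
  have KJ: "colon (supported K) J = W"
    using canonical_module_K fW by (simp add: J_def canonical_module_def)
  \<comment> \<open>Adjunction: taking the colon by all products is taking it by \<open>I\<close>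
    and then by \<open>J\<close>.\<close>
  have "colon W P = colon W {i * j |i j. i \<in> I \<and> j \<in> J}"
    unfolding P_def by (rule colon_hull[OF sW])
  also have "\<dots> = colon (colon W I) J"
  proof (rule set_eqI)
    fix x :: "'k fls"
    have eq: "x * j * i = x * (i * j)" for i j
      by (simp add: mult_ac)
    have "x \<in> colon W {i * j |i j. i \<in> I \<and> j \<in> J} \<longleftrightarrow> (\<forall>j\<in>J. \<forall>i\<in>I. x * j * i \<in> W)"
      unfolding colon_def eq by blast
    also have "\<dots> \<longleftrightarrow> x \<in> colon (colon W I) J"
      by (simp add: colon_def)
    finally show "x \<in> colon W {i * j |i j. i \<in> I \<and> j \<in> J} \<longleftrightarrow> x \<in> colon (colon W I) J" .
  qed
  also have "\<dots> = W"
    by (simp add: WI KJ)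
  finally have WP: "colon W P = W" .
  have prod_in: "i * j \<in> R" if "i \<in> I" "j \<in> J" for i j
  proof -
    have "i * j * v \<in> W" if "v \<in> W" for v
      using that \<open>i \<in> I\<close> \<open>j \<in> J\<close> by (auto simp: I_def J_def colon_def mult.assoc)
    then show ?thesis
      unfolding canonical_colon_self[OF W, symmetric] by (simp add: colon_def)
  qed
  have sR: "submodule R R"
    using fractional_ideal_R by (simp add: fractional_ideal_def)
  have PR: "P \<subseteq> R"
    unfolding P_def using prod_in by (intro hull_minimal sR) auto
  \<comment> \<open>Common denominators give the nonzero element \<open>w0 * d * d'\<close> of
    \<open>P\<close>, so that reflexivity applies to \<open>P\<close>.\<close>
  obtain w0 where w0: "w0 \<in> W" "w0 \<noteq> 0"
    using fW sW by (auto simp: fractional_ideal_def submodule_def)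
  obtain d where d: "d \<in> R" "d \<noteq> 0" "\<And>y. y \<in> supported K \<Longrightarrow> d * y \<in> R"
    using fractional_ideal_K by (auto simp: fractional_ideal_def)
  obtain d' where d': "d' \<in> R" "d' \<noteq> 0" "\<And>y. y \<in> W \<Longrightarrow> d' * y \<in> R"
    using fW by (auto simp: fractional_ideal_def)
  have "w0 * d * y \<in> W" if "y \<in> supported K" for y
    using sW w0(1) d(3)[OF that] by (metis mult.assoc mult.commute submodule_def)
  then have "w0 * d \<in> I"
    by (simp add: I_def colon_def)
  moreover have "d' \<in> J"
    using d'(3) R_subset_K by (auto simp: J_def colon_def)
  ultimately have "w0 * d * d' \<in> P"
    unfolding P_def by (intro hull_inc) blast
  then have "P \<noteq> {0}"
    using w0(2) d(2) d'(2) by auto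
  then have "fractional_ideal R P"
    unfolding fractional_ideal_def
    using PR submodule_hull one_in_R by (auto simp: P_def intro!: bexI[of _ 1])
  \<comment> \<open>\<open>P = colon W (colon W P) = colon W W = R\<close>.\<close>
  then have "P = R"
    using W WP canonical_colon_self[OF W] by (metis canonical_module_def)
  have "\<exists>i\<in>I. \<exists>j\<in>J. fls_nth (i * j) 0 \<noteq> 0"
  proof (rule ccontr)
    assume "\<not> ?thesis"
    then have "{i * j |i j. i \<in> I \<and> j \<in> J} \<subseteq> supported (S - {0})"
      using prod_in by (auto simp: R_def supported_def)
    moreover have "submodule R (supported (S - {0}))"
      unfolding R_def
    proof (rule submodule_supported)
      fix i j assume "i \<in> S" "j \<in> S - {0}"
      then show "i + j \<in> S - {0}"
        using add_in[of i j] nonneg[of i] nonneg[of j] by auto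
    qed
    ultimately have "P \<subseteq> supported (S - {0})"
      unfolding P_def by (rule hull_minimal)
    then show False
      using one_in_R \<open>P = R\<close> by auto
  qed
  then obtain i j where ij: "i \<in> I" "j \<in> J" "fls_nth (i * j) 0 \<noteq> 0"
    by blast
  then obtain u where u: "u \<in> R" "i * j * u = 1"
    using ex_inverse_in_R prod_in by blast
  show thesis
  proof
    show "i * u \<in> W"
      using ij(1) u(1) R_subset_K by (auto simp: I_def colon_def)
    show "j * (i * u) = 1"
      using u(2) by (simp add: mult_ac)
    show "j * v \<in> supported K" if "v \<in> W" for v
      using ij(2) that by (simp add: J_def colon_def)
  qed
qed

lemma far_flung_Gorenstein_imp_K_plus_K:
  assumes "far_flung_Gorenstein R" "0 \<le> n"
  shows "\<exists>y\<in>K. n - y \<in> K"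
proof (rule ccontr)
  assume "\<not> ?thesis"
  then have no: "n - y \<notin> K" if "y \<in> K" for y
    using that by blast
  obtain W where W: "canonical_module R W" "trace_ideal R W = conductor R"
    using assms(1) by (auto simp: far_flung_Gorenstein_def)
  obtain j w where jw: "w \<in> W" "j * w = 1" "\<And>v. v \<in> W \<Longrightarrow> j * v \<in> supported K"
    using canonical_module_scaling[OF W(1)] by blast
  \<comment> \<open>Multiplication by \<open>j\<close> maps \<open>W\<close> into
    \<open>supported K\<close> and \<open>w\<close> to 1, so multiplication by \<open>x\<close> maps
    \<open>w\<close> to \<open>t^(F - n)\<close>, which is outside the conductor because
    \<open>0 \<le> n\<close>.\<close>
  define x where "x = fls_monom (F - n) * j"
  have "fls_monom (F - n) * g \<in> R" if g: "g \<in> supported K" for g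
    unfolding R_def
  proof (rule supportedI)
    fix m assume "fls_nth (fls_monom (F - n) * g) m \<noteq> 0"
    \<comment> \<open>With \<open>y = m - (F - n)\<close> one has \<open>n - y = F - m\<close>, and
      this lies outside \<open>K\<close> exactly when \<open>m \<in> S\<close>.\<close>
    then have "m - (F - n) \<in> K"
      using supportedD[OF g] by simp
    from no[OF this] show "m \<in> S"
      by (simp add: K_def)
  qed
  then have "x * v \<in> R" if "v \<in> W" for v
    using jw(3)[OF that] by (simp add: x_def mult.assoc)
  then have "(*) x \<in> module_hom R W R"
    by (auto simp: module_hom_def distrib_left mult.left_commute)
  then have "x * w \<in> trace_ideal R W"
    unfolding trace_ideal_def using jw(1) by (intro hull_inc) blast
  moreover have "x * w = fls_monom (F - n)"
    by (simp add: x_def mult.assoc jw(2))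
  ultimately show False
    using assms(2) by (simp add: W(2) conductor_eq)
qed

end

subsection \<open>Type and reduced type\<close>

locale numerical_semigroup_mult = numerical_semigroup_fls +
  fixes e :: nat
  assumes mult_in: "int e \<in> S" and mult_pos: "0 < e"
    and mult_le: "h \<in> S \<Longrightarrow> h \<noteq> 0 \<Longrightarrow> int e \<le> h"
begin

definition Apery :: "int set" where
  "Apery = {n \<in> S. n - int e \<notin> S}"

text \<open>The pseudo-Frobenius numbers, shifted by the multiplicity.\<close>

definition maximal_Apery :: "int set" where
  "maximal_Apery = {n \<in> Apery. \<forall>h\<in>S - {0}. n + h - int e \<in> S}"

definition large_Apery :: "int set" where
  "large_Apery = {n \<in> Apery. F < n}"

lemma finite_Apery: "finite Apery"
proof (rule finite_subset)
  show "Apery \<subseteq> {0..F + int e}"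
    using nonneg gt_Frobenius by (fastforce simp: Apery_def not_less[symmetric])
qed simp

text \<open>Nonzero elements of \<open>S\<close> are at least \<open>e\<close>, so
  \<open>n + h - e\<close> is still above \<open>F\<close>. This gives one half of the comparison:
  the reduced type is at most the type.\<close>

lemma large_subset_maximal_Apery: "large_Apery \<subseteq> maximal_Apery"
proof
  fix n assume n: "n \<in> large_Apery"
  have "n + h - int e \<in> S" if "h \<in> S - {0}" for h
    using n that mult_le[of h] by (intro gt_Frobenius) (auto simp: large_Apery_def)
  then show "n \<in> maximal_Apery"
    using n by (auto simp: large_Apery_def maximal_Apery_def)
qed

lemma shifted_mem_iff: "n \<in> (+) (int e) ` S \<longleftrightarrow> n - int e \<in> S"
  by (auto intro: image_eqI[of _ _ "n - int e"])

lemma shifted_subset: "(+) (int e) ` S \<subseteq> S"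
  using mult_in add_in by auto

lemma X_power_times_R: "(fls_X ^ e) *o R = supported ((+) (int e) ` S)"
  by (simp add: fls_X_power_eq_monom R_def monom_times_supported)

lemma reduced_type_eq: "reduced_type R e = card large_Apery"
proof -
  let ?E = "{F<..} \<union> (+) (int e) ` S" and ?D = "(+) (int e) ` S"
  have eq: "?E - ?D = large_Apery"
    by (auto simp: large_Apery_def Apery_def shifted_mem_iff gt_Frobenius)
  have "finite (?E - ?D)"
    unfolding eq using finite_Apery by (simp add: large_Apery_def)
  then have "quotient_dim (supported ?E) (supported ?D :: 'a fls set) = card (?E - ?D)"
    by (rule quotient_dim_supported) simp
  then show ?thesis
    unfolding reduced_type_def X_power_times_R conductor_eq supported_plus_supported eq .
qed

lemma cm_type_eq: "cm_type R e = card maximal_Apery"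
proof -
  let ?E = "{n \<in> S. \<forall>h\<in>S - {0}. n + h - int e \<in> S}" and ?D = "(+) (int e) ` S"
  have socle: "R \<inter> colon (supported ?D) (supported (S - {0})) = (supported ?E :: 'a fls set)"
  proof (intro equalityI subsetI)
    fix f :: "'a fls" assume f: "f \<in> R \<inter> colon (supported ?D) (supported (S - {0}))"
    show "f \<in> supported ?E"
    proof (rule supportedI, intro CollectI conjI ballI)
      fix n assume n: "fls_nth f n \<noteq> 0"
      show "n \<in> S"
        using f n supportedD by (auto simp: R_def)
      fix h assume "h \<in> S - {0}"
      then have "f * fls_monom h \<in> supported ?D"
        using f by (auto simp: colon_def)
      then have "n + h \<in> ?D"
        by (rule supportedD) (use n in simp)
      then show "n + h - int e \<in> S"
        by (simp only: shifted_mem_iff)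
    qed
  next
    fix f :: "'a fls" assume f: "f \<in> supported ?E"
    have "f * g \<in> supported ?D" if g: "g \<in> supported (S - {0})" for g
      by (rule supported_mult[OF f g]) (simp add: shifted_mem_iff)
    moreover have "f \<in> R"
      unfolding R_def by (rule subsetD[OF supported_mono f]) auto
    ultimately show "f \<in> R \<inter> colon (supported ?D) (supported (S - {0}))"
      by (simp add: colon_def)
  qed
  have eq: "?E - ?D = maximal_Apery"
    by (auto simp: maximal_Apery_def Apery_def shifted_mem_iff)
  have "finite (?E - ?D)"
    unfolding eq using finite_Apery by (simp add: maximal_Apery_def)
  moreover have "?D \<subseteq> ?E"
    using shifted_subset add_in by (auto simp: add.assoc)
  ultimately have "quotient_dim (supported ?E) (supported ?D :: 'a fls set) = card (?E - ?D)"
    by (rule quotient_dim_supported)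
  then show ?thesis
    unfolding cm_type_def X_power_times_R max_ideal_eq socle eq .
qed

section \<open>Apery elements modulo the multiplicity\<close>

lemma add_multiple: "n \<in> S \<Longrightarrow> n + int k * int e \<in> S"
proof (induction k)
  case (Suc k)
  then show ?case
    using add_in[OF _ mult_in, of "n + int k * int e"] by (simp add: algebra_simps)
qed simp

lemma cong_mod_less:
  assumes "n \<in> S" "n mod int e = m mod int e" "n < m"
  shows "m - int e \<in> S"
proof -
  obtain k where k: "m - n = int e * k"
    using assms(2) by (metis mod_eq_dvd_iff dvdE)
  then have "0 < k"
    using assms(3) mult_pos by (metis diff_gt_0_iff_gt of_nat_0_less_iff zero_less_mult_pos)
  then have "m - int e = n + int (nat (k - 1)) * int e"
    using k by (simp add: algebra_simps)
  then show ?thesis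
    using add_multiple[OF assms(1)] by metis
qed

text \<open>Of two distinct congruent elements of \<open>S\<close>, the larger stays in
  \<open>S\<close> after subtracting \<open>e\<close>, so it is not an Apery element.\<close>

lemma inj_on_mod_Apery: "inj_on (\<lambda>n. n mod int e) Apery"
proof (rule inj_onI)
  fix m n assume "m \<in> Apery" "n \<in> Apery" "m mod int e = n mod int e"
  then show "m = n"
    using cong_mod_less[of m n] cong_mod_less[of n m] by (cases m n rule: linorder_cases) (auto simp: Apery_def)
qed

lemma zero_in_Apery: "0 \<in> Apery"
  using zero_in nonneg[of "- int e"] mult_pos by (auto simp: Apery_def)

lemma card_Apery_le: "card Apery \<le> e"
proof -
  have "card ((\<lambda>n. n mod int e) ` Apery) \<le> card {0..<int e}"
    using mult_pos by (intro card_mono) auto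
  then show ?thesis
    by (simp add: card_image[OF inj_on_mod_Apery])
qed

lemma maximal_Apery_subset: "maximal_Apery \<subseteq> Apery - {0}"
proof -
  \<comment> \<open>The witness \<open>h = F + e\<close> excludes 0, since
    \<open>0 + h - e = F\<close>.\<close>
  have "F + int e \<in> S" "F + int e \<noteq> 0"
    using Frobenius_pos mult_pos by (auto intro: gt_Frobenius)
  then have "0 \<notin> maximal_Apery"
    using Frobenius_notin by (auto simp: maximal_Apery_def intro!: bexI[of _ "F + int e"])
  then show ?thesis
    by (auto simp: maximal_Apery_def)
qed

lemma card_maximal_Apery_less: "card maximal_Apery < e"
proof -
  have "card maximal_Apery \<le> card (Apery - {0})"
    using finite_Apery by (intro card_mono maximal_Apery_subset) auto
  then show ?thesis
    using card_Apery_le zero_in_Apery finite_Apery mult_pos by (simp add: card_Diff_singleton)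
qed

lemma maximal_Apery_eq:
  assumes "card maximal_Apery = e - 1"
  shows "maximal_Apery = Apery - {0}"
  using assms card_Apery_le zero_in_Apery finite_Apery
  by (intro card_seteq maximal_Apery_subset) (auto simp: card_Diff_singleton)

text \<open>The reflection \<open>y = F + e - n\<close> turns \<open>n > F\<close> into
  \<open>y < e\<close> and \<open>n - e \<notin> S\<close> into \<open>y \<in> K\<close>;
  \<open>n \<in> S\<close> is automatic above \<open>F\<close>.\<close>

lemma card_large_Apery: "card large_Apery = card {y \<in> K. y < int e}"
proof (rule bij_betw_same_card[of "\<lambda>n. F + int e - n"], rule bij_betwI[of _ _ _ "\<lambda>y. F + int e - y"])
qed (auto simp: large_Apery_def Apery_def K_def gt_Frobenius algebra_simps)

lemma far_flung_Gorenstein_imp_sums: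
  assumes "far_flung_Gorenstein R"
  shows "\<forall>n\<in>{0..<int e}. \<exists>y\<in>{y \<in> K. y < int e}. \<exists>z\<in>{y \<in> K. y < int e}. n = y + z"
proof
  fix n assume n: "n \<in> {0..<int e}"
  then obtain y where "y \<in> K" "n - y \<in> K"
    using far_flung_Gorenstein_imp_K_plus_K[OF assms] by auto
  then show "\<exists>y\<in>{y \<in> K. y < int e}. \<exists>z\<in>{y \<in> K. y < int e}. n = y + z"
    using K_nonneg[of y] K_nonneg[of "n - y"] n
    by (intro bexI[of _ y] bexI[of _ "n - y"]) auto
qed

text \<open>The irreducible elements of \<open>S\<close>; they turn out to be the minimal
  generators, so their number is the embedding dimension.\<close>

definition atoms :: "int set" where
  "atoms = {h \<in> S - {0}. \<forall>x\<in>S - {0}. \<forall>y\<in>S - {0}. h \<noteq> x + y}"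

text \<open>The largest possible type forces minimal multiplicity. Every nonzero Apery element is
  then maximal. If such an \<open>h\<close> were \<open>x + y\<close>, then \<open>x\<close> would
  be Apery too, hence maximal, and \<open>h - e = x + y - e\<close> would lie in \<open>S\<close>.
  Conversely, an atom other than \<open>e\<close> is Apery.\<close>

lemma card_atoms:
  assumes "card maximal_Apery = e - 1"
  shows "card atoms = e"
proof -
  have "atoms = insert (int e) (Apery - {0})"
  proof (intro equalityI subsetI)
    fix h assume h: "h \<in> atoms"
    have "h - int e \<notin> S" if "h \<noteq> int e"
    proof
      assume "h - int e \<in> S"
      moreover have "h = int e + (h - int e)" by simp
      ultimately show False
        using h mult_in mult_pos that unfolding atoms_def by fastforce
    qed
    then show "h \<in> insert (int e) (Apery - {0})"
      using h by (auto simp: atoms_def Apery_def)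
  next
    fix h assume "h \<in> insert (int e) (Apery - {0})"
    then consider "h = int e" | "h \<in> Apery" "h \<noteq> 0" by blast
    then show "h \<in> atoms"
    proof cases
      case 1
      have "int e \<noteq> x + y" if "x \<in> S - {0}" "y \<in> S - {0}" for x y
        using that mult_le[of x] mult_le[of y] mult_pos by auto
      then show ?thesis
        using 1 mult_in mult_pos by (simp add: atoms_def)
    next
      case 2
      have "h \<noteq> x + y" if xy: "x \<in> S - {0}" "y \<in> S - {0}" for x y
      proof
        assume eq: "h = x + y"
        have "x \<in> Apery"
          using add_in[of "x - int e" y] 2 xy eq by (auto simp: Apery_def algebra_simps)
        then have "x \<in> maximal_Apery"
          using xy maximal_Apery_eq[OF assms] by simp
        then show False
          using xy 2 eq by (auto simp: maximal_Apery_def Apery_def)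
      qed
      then show ?thesis
        using 2 by (auto simp: atoms_def Apery_def)
    qed
  qed
  moreover have "int e \<notin> Apery"
    using zero_in by (simp add: Apery_def)
  ultimately have "card atoms = Suc (card (Apery - {0}))"
    using finite_Apery by simp
  then show ?thesis
    using assms maximal_Apery_eq[OF assms] mult_pos by simp
qed

end

section \<open>Covering an interval by sums, and comparing the two types\<close>

lemma few_sums_bound:
  fixes Q :: "int set"
  assumes "\<forall>n\<in>{0..<int e}. \<exists>y\<in>Q. \<exists>z\<in>Q. n = y + z"
    and "finite Q" "\<forall>y\<in>Q. 0 \<le> y" "0 \<in> Q" "card Q \<le> 3"
  shows "e \<le> 5" "card Q \<le> 2 \<Longrightarrow> e \<le> 3" "card Q \<le> 1 \<Longrightarrow> e \<le> 1"
proof -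
  have Q: "Q = insert 0 (Q - {0})" and fin: "finite (Q - {0})"
    using assms by auto
  have card_Q: "card Q = Suc (card (Q - {0}))"
    using assms(2,4) by (rule card.remove)
  have sums: "\<exists>y\<in>insert 0 (Q - {0}). \<exists>z\<in>insert 0 (Q - {0}). n = y + z"
    if "0 \<le> n" "n < int e" for n
    using assms(1) that Q by simp
  have one: "e \<le> 1" if "card Q \<le> 1"
  proof -
    have empty: "Q - {0} = {}"
      using that card_Q fin by simp
    show ?thesis
      using sums[of 1] unfolding empty by (cases "e \<le> 1") auto
  qed
  have two: "e \<le> 3" if "card Q = 2"
  proof -
    have "card (Q - {0}) = 1"
      using that card_Q by simp
    then obtain a where a: "Q - {0} = {a}"
      by (rule card_1_singletonE)
    have "n = a \<or> n = a + a" if "0 < n" "n < int e" for n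
      using sums[of n] that unfolding a by auto
    \<comment> \<open>The two values \<open>a\<close> and \<open>a + a\<close> cannot cover 1, 2 and
      3.\<close>
    from this[of 1] this[of 2] this[of 3] show ?thesis
      by linarith
  qed
  have three: "e \<le> 5" if "card Q = 3"
  proof -
    have "card (Q - {0}) = 2"
      using that card_Q by simp
    then obtain a b where ab: "Q - {0} = {a, b}"
      by (auto simp: card_2_iff)
    have pos: "0 < a" "0 < b"
      using assms(3) ab by (auto simp: order_le_less)
    have "n = a \<or> n = b \<or> n = a + a \<or> n = a + b \<or> n = b + b"
      if "0 < n" "n < int e" for n
      using sums[of n] that unfolding ab by auto
    \<comment> \<open>Covering 1 makes one summand equal to 1; covering 3 makes the other 2 or 3;
      neither choice reaches 5.\<close>
    note sum_cases = this[of 1] this[of 3] this[of 5]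
    show ?thesis
    proof (rule ccontr)
      assume "\<not> e \<le> 5"
      then have cases: "1 = a \<or> 1 = b"
          "3 = a \<or> 3 = b \<or> 3 = a + a \<or> 3 = a + b \<or> 3 = b + b"
          "5 = a \<or> 5 = b \<or> 5 = a + a \<or> 5 = a + b \<or> 5 = b + b"
        using sum_cases pos by auto
      from cases(1) show False
        by (rule disjE) (use cases(2,3) in auto)
    qed
  qed
  show "e \<le> 5" "card Q \<le> 2 \<Longrightarrow> e \<le> 3" "card Q \<le> 1 \<Longrightarrow> e \<le> 1"
    using one two three assms(5) card_Q by linarith+
qed

lemma (in numerical_semigroup_mult) far_flung_Gorenstein_card_eq:
  assumes ff: "far_flung_Gorenstein R"
    and type: "card maximal_Apery \<le> 3 \<or> (card maximal_Apery = 4 \<and> card atoms \<noteq> e)"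
  shows "card large_Apery = card maximal_Apery"
proof (rule ccontr)
  let ?Q = "{y \<in> K. y < int e}"
  assume "\<not> ?thesis"
  moreover have "card large_Apery \<le> card maximal_Apery"
    using finite_Apery large_subset_maximal_Apery by (intro card_mono) (auto simp: maximal_Apery_def)
  ultimately have less: "card ?Q < card maximal_Apery"
    by (simp add: card_large_Apery)
  have nonneg: "\<forall>y\<in>?Q. 0 \<le> y"
    using K_nonneg by simp
  then have "?Q \<subseteq> {0..int e}"
    by auto
  then have finite: "finite ?Q"
    by (rule finite_subset) simp
  have zero: "0 \<in> ?Q"
    using zero_in_K mult_pos by simp
  have "card ?Q \<le> 3"
    using less type by linarith
  note few_sums_bound[OF far_flung_Gorenstein_imp_sums[OF ff] finite nonneg zero this]
  \<comment> \<open>If \<open>?Q\<close> had at most 1 or 2 elements, \<open>e\<close> would be at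
    most 1 or 3, against \<open>card ?Q < card maximal_Apery < e\<close>.\<close>
  then have "e = 5" and "card maximal_Apery = 4"
    using less type card_maximal_Apery_less by linarith+
  then show False
    using type card_atoms by simp
qed

subsection \<open>Minimal generators\<close>

lemma submonoid_hull: "submonoid (submonoid hull X)"
  by (rule hull_in) (auto simp: submonoid_def)

lemma minimal_generators_nonzero:
  assumes "minimal_generators A H"
  shows "0 \<notin> A"
proof
  assume "0 \<in> A"
  have "submonoid hull insert 0 (A - {0}) = submonoid hull (A - {0})"
    using submonoid_hull[of "A - {0}"] by (intro hull_redundant) (simp add: submonoid_def)
  then have "submonoid hull (A - {0}) = H"
    using assms \<open>0 \<in> A\<close> by (simp add: minimal_generators_def insert_absorb)
  then show False
    using assms \<open>0 \<in> A\<close> unfolding minimal_generators_def by blast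
qed

lemma minimal_generators_eq_atoms:
  assumes "minimal_generators A H"
  shows "A = {h \<in> H - {0}. \<forall>x\<in>H - {0}. \<forall>y\<in>H - {0}. h \<noteq> x + y}"
proof (intro equalityI subsetI)
  have hull: "submonoid hull A = H" and min: "\<And>B. B \<subset> A \<Longrightarrow> submonoid hull B \<noteq> H"
    using assms by (auto simp: minimal_generators_def)
  have AH: "A \<subseteq> H" and H: "submonoid H"
    using hull_subset[of A submonoid] submonoid_hull[of A] by (auto simp: hull)
  fix h
  {
    assume h: "h \<in> {h \<in> H - {0}. \<forall>x\<in>H - {0}. \<forall>y\<in>H - {0}. h \<noteq> x + y}"
    show "h \<in> A"
    proof (rule ccontr)
      assume "h \<notin> A"
      then have "A \<subseteq> H - {h}"
        using AH by blast
      \<comment> \<open>Removing an irreducible element leaves a submonoid, so every generating set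
        must contain it.\<close>
      moreover have "submonoid (H - {h})"
        unfolding submonoid_def
      proof (intro conjI ballI)
        show "0 \<in> H - {h}"
          using H h by (simp add: submonoid_def)
        fix x y assume "x \<in> H - {h}" "y \<in> H - {h}"
        then show "x + y \<in> H - {h}"
          using H h by (cases "x = 0 \<or> y = 0") (auto simp: submonoid_def)
      qed
      ultimately have "H \<subseteq> H - {h}"
        using hull_minimal[of A "H - {h}" submonoid] by (simp add: hull)
      then show False
        using h by blast
    qed
  }
  assume h: "h \<in> A"
  let ?M = "submonoid hull (A - {h})"
  have M: "submonoid ?M"
    by (rule submonoid_hull)
  have "h \<notin> ?M"
  proof
    assume "h \<in> ?M"
    then have "submonoid hull insert h (A - {h}) = ?M"
      by (rule hull_redundant)
    then have "?M = H"
      using h by (simp add: insert_absorb hull)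
    then show False
      using min[of "A - {h}"] h by blast
  qed
  \<comment> \<open>Elements of \<open>H\<close> below \<open>h\<close> therefore lie in
    \<open>?M\<close>. A decomposition of \<open>h\<close> into nonzero parts has both parts below
    \<open>h\<close>, which would put \<open>h\<close> into \<open>?M\<close> and make it
    redundant.\<close>
  have "submonoid (?M \<union> {h..})"
    using M unfolding submonoid_def by (auto intro: trans_le_add1 trans_le_add2)
  moreover have "A \<subseteq> ?M \<union> {h..}"
    using hull_subset[of "A - {h}" submonoid] by blast
  ultimately have small: "H \<subseteq> ?M \<union> {h..}"
    using hull_minimal[of A _ submonoid] unfolding hull by blast
  have "h \<noteq> x + y" if xy: "x \<in> H - {0}" "y \<in> H - {0}" for x y
  proof
    assume eq: "h = x + y"
    then have "x \<notin> {h..}" "y \<notin> {h..}"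
      using xy by auto
    then have "x \<in> ?M" "y \<in> ?M"
      using small xy by blast+
    then show False
      using M \<open>h \<notin> ?M\<close> eq by (auto simp: submonoid_def)
  qed
  then show "h \<in> {h \<in> H - {0}. \<forall>x\<in>H - {0}. \<forall>y\<in>H - {0}. h \<noteq> x + y}"
    using AH h minimal_generators_nonzero[OF assms] by blast
qed

text \<open>The numbers from \<open>Min A\<close> on, together with 0, form a submonoid containing
  \<open>A\<close>.\<close>

lemma Min_minimal_generators_le:
  assumes "minimal_generators A H" "h \<in> H" "h \<noteq> 0"
  shows "Min A \<le> h"
proof -
  have fin: "finite A" and hull: "submonoid hull A = H"
    using assms(1) by (auto simp: minimal_generators_def)
  have "A \<subseteq> insert 0 {Min A..}"
    using fin by auto
  moreover have "submonoid (insert 0 {Min A..})"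
    by (auto simp: submonoid_def)
  ultimately have "H \<subseteq> insert 0 {Min A..}"
    using hull_minimal[of A _ submonoid] unfolding hull by blast
  then show ?thesis
    using assms(2,3) by auto
qed

theorem theorem4:
  fixes H A :: "nat set"
    and R :: "'k::{alg_closed_field, field_char_0} fls set"
  assumes "numerical_semigroup H" and "H \<noteq> UNIV"
    and "minimal_generators A H"
    and "R = semigroup_ring H"
    and "far_flung_Gorenstein R"
    and "cm_type R (multiplicity_of A) \<le> 3 \<or>
         (cm_type R (multiplicity_of A) = 4 \<and> \<not> minimal_multiplicity A)"
  shows "maximal_reduced_type R (multiplicity_of A)"
proof -
  have H: "submonoid H" and gaps: "finite (UNIV - H)" "UNIV - H \<noteq> {}"
    using assms(1,2) by (auto simp: numerical_semigroup_def)
  define f where "f = Max (UNIV - H)"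
  have f: "f \<notin> H"
    using Max_in[OF gaps] by (simp add: f_def)
  have f_less: "n \<in> H" if "f < n" for n
    using Max_ge[OF gaps(1), of n] that by (auto simp: f_def)
  have "0 < f"
    using f H by (cases f) (auto simp: submonoid_def)
  have finA: "finite A" and hull: "submonoid hull A = H"
    using assms(3) by (auto simp: minimal_generators_def)
  have "A \<noteq> {}"
  proof
    assume "A = {}"
    then have "H \<subseteq> {0}"
      using hull hull_minimal[of A "{0}" submonoid] by (simp add: submonoid_def)
    then show False
      using f_less[of "Suc f"] by auto
  qed
  then have "Min A \<in> A"
    using finA by simp
  then have e: "Min A \<in> H" "0 < Min A"
    using minimal_generators_eq_atoms[OF assms(3)] by auto
  interpret numerical_semigroup_mult "int ` H" "int f" R "Min A"
  proof
    show "R = supported (int ` H)"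
      by (simp add: assms(4) semigroup_ring_eq_supported)
    show "m + n \<in> int ` H" if "m \<in> int ` H" "n \<in> int ` H" for m n
      using that H by (auto simp: submonoid_def simp flip: of_nat_add)
    show "n \<in> int ` H" if "int f < n" for n
      using that f_less[of "nat n"] by (intro image_eqI[of _ _ "nat n"]) auto
    show "int (Min A) \<le> h" if "h \<in> int ` H" "h \<noteq> 0" for h
      using that Min_minimal_generators_le[OF assms(3)] by auto
  qed (use H f e \<open>0 < f\<close> in \<open>auto simp: submonoid_def\<close>)
  have "int ` A = atoms"
  proof -
    have "int ` H - {0} = int ` (H - {0})"
      by auto
    then show ?thesis
      unfolding atoms_def by (subst minimal_generators_eq_atoms[OF assms(3)])
        (auto simp flip: of_nat_add)
  qed
  \<comment> \<open>Non-minimal multiplicity thus becomes the condition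
    \<open>card atoms \<noteq> e\<close>.\<close>
  then have "card atoms = card A"
    by (metis card_image inj_on_of_nat)
  then have "card large_Apery = card maximal_Apery"
    using assms(5,6) by (intro far_flung_Gorenstein_card_eq)
      (auto simp: cm_type_eq multiplicity_of_def minimal_multiplicity_def embedding_dim_def)
  then show ?thesis
    by (simp add: maximal_reduced_type_def reduced_type_eq cm_type_eq multiplicity_of_def)
qed

end
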